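(* Let $k\ge1$ and $\mathbf{n}=[n_1,\dots,n_k]$ nonnegative integers with $n=\sum_i n_i\ge2$. Choose uniformly at random one of the $n!/(n_1!\cdots n_k!)$ sequences $(a_1,\dots,a_n)$ over $\{1,\dots,k\}$ in which each integer $j$ appears exactly $n_j$ times, and let $R$ be the number of indices $t$ with $a_{t+1}-a_t=1$. Let $T_1=\sum_{i=1}^{k-1}n_in_{i+1}$. Then $$\mathbb{E}[R(R-1)]=\frac{1}{n(n-1)}\Big[T_1^2-\sum_{i=1}^{k-1}n_in_{i+1}(n_i+n_{i+1}-1)\Big],$$ and $$\operatorname{Var}(R)=\frac{T_1^2}{n^2(n-1)}+\frac{T_1}{n-1}-\frac{1}{n(n-1)}\sum_{i=1}^{k-1}n_in_{i+1}(n_i+n_{i+1}).$$ *)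

theory Defs
  imports "HOL-Probability.Probability" "HOL-Combinatorics.Multiset_Permutations"
begin

text \<open>Only the values \<open>n 1, \<dots>, n k\<close> of the multiplicity function are relevant.\<close>

definition arrangements :: "nat \<Rightarrow> (nat \<Rightarrow> nat) \<Rightarrow> nat list set" where
  "arrangements k n =
     {xs. length xs = (\<Sum>i=1..k. n i) \<and> set xs \<subseteq> {1..k} \<and> (\<forall>j\<in>{1..k}. count_list xs j = n j)}"

text \<open>Lists are indexed from \<open>0\<close>; the difference is taken in the integers.\<close>

definition unit_rises :: "nat list \<Rightarrow> nat" where
  "unit_rises xs = card {t. Suc t < length xs \<and> int (xs ! Suc t) - int (xs ! t) = 1}"

definition T1 :: "nat \<Rightarrow> (nat \<Rightarrow> nat) \<Rightarrow> real" where
  "T1 k n = (\<Sum>i=1..k-1. real (n i) * real (n (i + 1)))"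

text \<open>The uniform distribution on \<open>arrangements k n\<close> is meaningful, since
  this set is finite and nonempty, of the expected multinomial cardinality.\<close>

lemma arrangements_eq:
  "arrangements k n = permutations_of_multiset (\<Sum>j\<in>{1..k}. replicate_mset (n j) j)"
proof -
  have c: "count (\<Sum>j\<in>{1..k}. replicate_mset (n j) j) x = (if x \<in> {1..k} then n x else 0)" for x
    by (simp add: count_sum)
  have *: "mset xs = (\<Sum>j\<in>{1..k}. replicate_mset (n j) j) \<longleftrightarrow>
      (\<forall>x. count_list xs x = (if x \<in> {1..k} then n x else 0))" for xs
    by (simp only: multiset_eq_iff c count_mset)
  have l: "length xs = (\<Sum>i=1..k. n i)"
    if "mset xs = (\<Sum>j\<in>{1..k}. replicate_mset (n j) j)" for xs
  proof -
    have "length xs = size (mset xs)" by simp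
    then show ?thesis unfolding that by (simp add: size_multiset_sum)
  qed
  show ?thesis
  proof (intro equalityI subsetI)
    fix xs assume "xs \<in> arrangements k n"
    then show "xs \<in> permutations_of_multiset (\<Sum>j\<in>{1..k}. replicate_mset (n j) j)"
      unfolding permutations_of_multiset_def mem_Collect_eq *
      by (auto simp: arrangements_def count_list_0_iff)
  next
    fix xs assume "xs \<in> permutations_of_multiset (\<Sum>j\<in>{1..k}. replicate_mset (n j) j)"
    then have m: "mset xs = (\<Sum>j\<in>{1..k}. replicate_mset (n j) j)"
      by (simp add: permutations_of_multiset_def)
    then have q: "count_list xs x = (if x \<in> {1..k} then n x else 0)" for x
      using * by blast
    have "set xs \<subseteq> {1..k}"
      using q count_list_0_iff by (metis subsetI)
    then show "xs \<in> arrangements k n"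
      using q l[OF m] by (simp add: arrangements_def)
  qed
qed

lemma finite_arrangements: "finite (arrangements k n)"
  by (simp add: arrangements_eq)

lemma arrangements_nonempty: "arrangements k n \<noteq> {}"
  by (simp add: arrangements_eq)

lemma card_arrangements:
  "card (arrangements k n) = fact (\<Sum>i=1..k. n i) div (\<Prod>i=1..k. fact (n i))"
proof -
  let ?M = "\<Sum>j\<in>{1..k}. replicate_mset (n j) j"
  have c: "count ?M x = (if x \<in> {1..k} then n x else 0)" for x
    by (simp add: count_sum)
  have s: "size ?M = (\<Sum>i=1..k. n i)"
    by (simp add: size_multiset_sum)
  have "(\<Prod>x\<in>set_mset ?M. fact (count ?M x) :: nat) = (\<Prod>x=1..k. fact (count ?M x))"
  proof (rule prod.mono_neutral_left)
    show "set_mset ?M \<subseteq> {1..k}"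
    proof
      fix x assume "x \<in> set_mset ?M"
      then have "count ?M x \<noteq> 0" by (simp only: not_in_iff[symmetric] not_not)
      then show "x \<in> {1..k}" unfolding c by presburger
    qed
    show "\<forall>x\<in>{1..k} - set_mset ?M. fact (count ?M x) = (1::nat)"
    proof
      fix x assume "x \<in> {1..k} - set_mset ?M"
      then have "count ?M x = 0" unfolding not_in_iff[symmetric] by blast
      then show "fact (count ?M x) = (1::nat)" by (simp only: fact_0)
    qed
  qed simp
  also have "\<dots> = (\<Prod>x=1..k. fact (n x))"
    by (rule prod.cong[OF refl]) (simp only: c if_True)
  finally show ?thesis
    by (simp add: arrangements_eq card_permutations_of_multiset s)
qed

end

theory Submission
  imports Defs
begin

text \<open>A uniformly random arrangement is exchangeable: permuting positions permutes the
  arrangements. Hence the expectation of a function of the values at \<open>m\<close> fixed distinct positions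
  is its average over all \<open>m\<close>-tuples of distinct positions, and this average depends only on the
  multiplicities. In the second moment of \<open>R\<close> a pair of indices involves two positions
  (equal indices), three (adjacent indices) or four (all others). Multiplied by the number of index
  pairs of each kind, the averages over three and four positions
  both acquire the denominator \<open>N (N - 1)\<close>, and the count of triples \<open>i, i + 1, i + 2\<close> drops out.\<close>

section \<open>Exchangeability of positions\<close>

lemma inj_on_extends_to_permutes:
  assumes "finite S" "A \<subseteq> S" "inj_on f A" "f ` A \<subseteq> S"
  obtains \<sigma> where "\<sigma> permutes S" "\<And>x. x \<in> A \<Longrightarrow> \<sigma> x = f x"
proof -
  have fin: "finite A" using assms finite_subset by blast
  \<comment> \<open>The complements of \<open>A\<close> and of its image are equally large, so any
    bijection \<open>g\<close> between them completes \<open>f\<close> to a permutation.\<close>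
  have "card (S - A) = card (S - f ` A)"
    using assms fin by (simp add: card_Diff_subset card_image)
  then obtain g where g: "bij_betw g (S - A) (S - f ` A)"
    using finite_same_card_bij[of "S - A" "S - f ` A"] assms(1) by auto
  define h where "h = (\<lambda>x. if x \<in> A then f x else if x \<in> S then g x else x)"
  have "bij_betw h A (f ` A)"
    using inj_on_imp_bij_betw[OF assms(3)] by (rule iffD2[OF bij_betw_cong, rotated]) (simp add: h_def)
  moreover have "bij_betw h (S - A) (S - f ` A)"
    using g by (rule iffD2[OF bij_betw_cong, rotated]) (simp add: h_def)
  ultimately have "bij_betw h (A \<union> (S - A)) (f ` A \<union> (S - f ` A))"
    by (rule bij_betw_combine) auto
  moreover have "A \<union> (S - A) = S" "f ` A \<union> (S - f ` A) = S"
    using assms(2,4) by blast+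
  ultimately have "bij_betw h S S" by simp
  then have "h permutes S"
    by (rule bij_imp_permutes) (use assms(2) in \<open>auto simp: h_def\<close>)
  then show thesis by (rule that) (simp add: h_def)
qed

text \<open>Distinctness of \<open>ps\<close> makes the assignment of \<open>qs ! i\<close> to
  \<open>ps ! i\<close> well defined, distinctness of \<open>qs\<close> makes it injective; it then
  extends to all of \<open>S\<close>.\<close>

lemma distinct_lists_permutes:
  assumes "finite S" "distinct ps" "distinct qs" "set ps \<subseteq> S" "set qs \<subseteq> S"
    and len: "length ps = length qs"
  obtains \<sigma> where "\<sigma> permutes S" "map \<sigma> ps = qs"
proof -
  define f where "f = (\<lambda>x. the (map_of (zip ps qs) x))"
  have f: "f (ps ! i) = qs ! i" if "i < length ps" for i
    using that assms by (simp add: f_def map_of_zip_nth)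
  then have m: "map f ps = qs"
    using len by (intro nth_equalityI) auto
  then have "inj_on f (set ps)"
    using assms(2,3) distinct_map by blast
  moreover have "f ` set ps \<subseteq> S"
    using m assms(5) by auto
  ultimately obtain \<sigma> where s: "\<sigma> permutes S" "\<And>x. x \<in> set ps \<Longrightarrow> \<sigma> x = f x"
    using inj_on_extends_to_permutes assms(1,4) by metis
  then have "map \<sigma> ps = qs" unfolding m[symmetric] by simp
  then show thesis using s that by blast
qed

text \<open>Moving entries by a permutation \<sigma> of positions that takes \<open>ps\<close> to
  \<open>qs\<close> is a bijection of the arrangements onto themselves, under which the values read
  at \<open>ps\<close> become those read at \<open>qs\<close>.\<close>

lemma sum_permutations_of_multiset_exchangeable:
  assumes "distinct ps" "distinct qs" "set ps \<subseteq> {..<size M}" "set qs \<subseteq> {..<size M}"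
    and "length ps = length qs"
  shows "(\<Sum>xs\<in>permutations_of_multiset M. F (map ((!) xs) ps)) =
         (\<Sum>xs\<in>permutations_of_multiset M. F (map ((!) xs) qs))"
proof -
  obtain \<sigma> where s: "\<sigma> permutes {..<size M}" "map \<sigma> ps = qs"
    using distinct_lists_permutes[of "{..<size M}" ps qs] assms by auto
  have len: "length xs = size M" if "xs \<in> permutations_of_multiset M" for xs
    using that by (simp add: permutations_of_multiset_def flip: size_mset)
  have s': "inv \<sigma> permutes {..<size M}" using s(1) by (rule permutes_inv)
  show ?thesis
  proof (rule sum.reindex_bij_witness[where i = "permute_list \<sigma>" and j = "permute_list (inv \<sigma>)"])
    fix xs assume xs: "xs \<in> permutations_of_multiset M"
    note l = len[OF xs]
    have p: "\<sigma> permutes {..<length xs}" "inv \<sigma> permutes {..<length xs}"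
      using s(1) s' l by auto
    show "permute_list \<sigma> (permute_list (inv \<sigma>) xs) = xs"
      using permute_list_compose[OF p(1), of "inv \<sigma>"] permutes_inv_o(2)[OF p(1)] by simp
    show "permute_list (inv \<sigma>) (permute_list \<sigma> xs) = xs"
      using permute_list_compose[OF p(2), of "\<sigma>"] permutes_inv_o(1)[OF p(1)] by simp
    show "permute_list (inv \<sigma>) xs \<in> permutations_of_multiset M"
      using xs p by (simp add: permutations_of_multiset_def)
    show "permute_list \<sigma> xs \<in> permutations_of_multiset M"
      using xs p by (simp add: permutations_of_multiset_def)
    \<comment> \<open>Entry \<open>\<sigma> p\<close> of the permuted list is entry
      \<open>inv \<sigma> (\<sigma> p) = p\<close> of \<open>xs\<close>, which is why the inverse is
      applied.\<close>
    have "map ((!) (permute_list (inv \<sigma>) xs)) qs = map ((!) xs) ps"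
      unfolding s(2)[symmetric] using assms(3) l p permutes_in_image[OF s(1)]
      by (auto simp: permute_list_nth permutes_inverses(2)[OF s(1)])
    then show "F (map ((!) (permute_list (inv \<sigma>) xs)) qs) = F (map ((!) xs) ps)"
      by simp
  qed
qed

section \<open>Tuples of distinct positions\<close>

definition distinct_lists :: "nat \<Rightarrow> 'a set \<Rightarrow> 'a list set" where
  "distinct_lists m S = {ps. length ps = m \<and> distinct ps \<and> set ps \<subseteq> S}"

lemma finite_distinct_lists: "finite S \<Longrightarrow> finite (distinct_lists m S)"
  unfolding distinct_lists_def
  by (rule finite_subset[OF _ finite_lists_length_eq[of S m]]) auto

lemma distinct_lists_empty: "finite S \<Longrightarrow> card S < m \<Longrightarrow> distinct_lists m S = {}"
proof (rule equals0I)
  fix ps assume "finite S" "card S < m" "ps \<in> distinct_lists m S"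
  then show False
    using card_mono[of S "set ps"] by (simp add: distinct_lists_def distinct_card)
qed

text \<open>All tuples \<open>ps\<close> give the same sum over arrangements, so multiplying by
  their number amounts to summing over them; after swapping the sums, each arrangement contributes
  \<open>C\<close>.\<close>

lemma card_distinct_lists_times_sum:
  fixes F :: "'a list \<Rightarrow> real"
  assumes "qs \<in> distinct_lists m {..<size M}"
    and C: "\<And>xs. xs \<in> permutations_of_multiset M \<Longrightarrow>
          (\<Sum>ps\<in>distinct_lists m {..<size M}. F (map ((!) xs) ps)) = C"
  shows "real (card (distinct_lists m {..<size M})) *
           (\<Sum>xs\<in>permutations_of_multiset M. F (map ((!) xs) qs)) =
         real (card (permutations_of_multiset M)) * C"
proof -
  let ?L = "distinct_lists m {..<size M}" and ?A = "permutations_of_multiset M"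
  have "real (card ?L) * (\<Sum>xs\<in>?A. F (map ((!) xs) qs)) =
      (\<Sum>ps\<in>?L. \<Sum>xs\<in>?A. F (map ((!) xs) qs))"
    by simp
  also have "\<dots> = (\<Sum>ps\<in>?L. \<Sum>xs\<in>?A. F (map ((!) xs) ps))"
    using assms(1)
    by (intro sum.cong refl sum_permutations_of_multiset_exchangeable)
      (auto simp: distinct_lists_def)
  also have "\<dots> = (\<Sum>xs\<in>?A. C)"
    by (subst sum.swap) (simp add: C)
  finally show ?thesis by simp
qed

text \<open>Splits a tuple into head and tail. A repeated element gives a zero summand instead of a
  smaller index set, so the sums range over a full product and can be swapped.\<close>

lemma sum_distinct_lists_Suc:
  assumes "finite S"
  shows "(\<Sum>ps\<in>distinct_lists (Suc m) S. F ps) =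
         (\<Sum>p\<in>S. \<Sum>ps\<in>distinct_lists m S. if p \<in> set ps then 0 else F (p # ps))"
proof -
  let ?B = "{x \<in> S \<times> distinct_lists m S. fst x \<notin> set (snd x)}"
  have "(\<Sum>ps\<in>distinct_lists (Suc m) S. F ps) = (\<Sum>x\<in>?B. F (fst x # snd x))"
    by (rule sum.reindex_bij_witness[where i = "\<lambda>x. fst x # snd x" and j = "\<lambda>ps. (hd ps, tl ps)"])
      (auto simp: distinct_lists_def length_Suc_conv)
  also have "\<dots> = (\<Sum>x\<in>S \<times> distinct_lists m S. if fst x \<notin> set (snd x) then F (fst x # snd x) else 0)"
    using assms finite_distinct_lists[OF assms] by (subst sum.inter_filter) auto
  also have "\<dots> = (\<Sum>p\<in>S. \<Sum>ps\<in>distinct_lists m S. if p \<in> set ps then 0 else F (p # ps))"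
    by (subst sum.cartesian_product) (intro sum.cong, auto)
  finally show ?thesis .
qed

lemma distinct_lists_0: "distinct_lists 0 S = {[]}"
  by (auto simp: distinct_lists_def)

text \<open>A distinct tail of length \<open>m\<close> leaves \<open>card S - m\<close> choices for
  the head; \<open>m \<le> card S\<close> makes natural and real subtraction agree.\<close>

lemma card_distinct_lists_Suc:
  assumes "finite S" "m \<le> card S"
  shows "real (card (distinct_lists (Suc m) S)) =
         (real (card S) - real m) * real (card (distinct_lists m S))"
proof -
  have "real (card (distinct_lists (Suc m) S)) = (\<Sum>ps\<in>distinct_lists (Suc m) S. 1)"
    by simp
  also have "\<dots> = (\<Sum>ps\<in>distinct_lists m S. \<Sum>p\<in>S. if p \<in> set ps then 0 else 1)"
    unfolding sum_distinct_lists_Suc[OF assms(1)] by (rule sum.swap)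
  also have "\<dots> = (\<Sum>ps\<in>distinct_lists m S. real (card S) - real m)"
  proof (rule sum.cong[OF refl])
    fix ps assume ps: "ps \<in> distinct_lists m S"
    have "(\<Sum>p\<in>S. if p \<in> set ps then 0 else 1::real) = (\<Sum>p\<in>S - set ps. 1)"
      using assms(1) by (intro sum.mono_neutral_cong_right) auto
    also have "\<dots> = real (card S - card (set ps))"
      using ps by (simp add: distinct_lists_def card_Diff_subset)
    finally show "(\<Sum>p\<in>S. if p \<in> set ps then 0 else 1) = real (card S) - real m"
      using ps assms(2) by (simp add: distinct_lists_def distinct_card of_nat_diff)
  qed
  finally show ?thesis by simp
qed

section \<open>Sums of rises over positions as sums over values\<close>

text \<open>A real-valued indicator, so that powers of \<open>unit_rises\<close> expand into sums of
  products.\<close>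

definition rise :: "nat \<Rightarrow> nat \<Rightarrow> real" where
  "rise a b = of_bool (b = Suc a)"

lemma unit_rises_eq_sum:
  "real (unit_rises xs) = (\<Sum>t<length xs - 1. rise (xs ! t) (xs ! Suc t))"
proof -
  have "{t. Suc t < length xs \<and> int (xs ! Suc t) - int (xs ! t) = 1} =
      {t\<in>{..<length xs - 1}. xs ! Suc t = Suc (xs ! t)}"
    by auto
  then show ?thesis
    by (simp add: unit_rises_def rise_def of_bool_def sum.If_cases Int_def)
qed

lemma sum_list_map_eq_sum_count_list:
  assumes "finite A" "set xs \<subseteq> A"
  shows "sum_list (map f xs) = (\<Sum>x\<in>A. real (count_list xs x) * f x)"
  using assms(2)
proof (induction xs)
  case (Cons a xs)
  have "(\<Sum>x\<in>A. real (count_list (a # xs) x) * f x) =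
      (\<Sum>x\<in>A. real (count_list xs x) * f x + (if x = a then f x else 0))"
    by (intro sum.cong) (auto simp: algebra_simps)
  also have "\<dots> = (\<Sum>x\<in>A. real (count_list xs x) * f x) + f a"
    using Cons.prems assms(1) by (simp add: sum.distrib sum.delta)
  finally show ?case using Cons by simp
qed simp

text \<open>Grouping positions by value leaves only the multiplicities. Hence position sums agree
  for all arrangements, which supplies the constant \<open>C\<close> of
  \<open>card_distinct_lists_times_sum\<close>.\<close>

lemma arrangements_sum_nth:
  assumes "xs \<in> arrangements k n"
  shows "(\<Sum>p<length xs. f (xs ! p)) = (\<Sum>i=1..k. real (n i) * f i)"
proof -
  have "(\<Sum>p<length xs. f (xs ! p)) = sum_list (map f xs)"
    by (simp add: sum_list_sum_nth atLeast0LessThan)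
  also have "\<dots> = (\<Sum>i=1..k. real (count_list xs i) * f i)"
    using assms by (intro sum_list_map_eq_sum_count_list) (auto simp: arrangements_def)
  also have "\<dots> = (\<Sum>i=1..k. real (n i) * f i)"
    using assms by (intro sum.cong) (auto simp: arrangements_def)
  finally show ?thesis .
qed

lemma sum_rise_right:
  "(\<Sum>j=1..k. real (n j) * rise i j) = (if i < k then real (n (Suc i)) else 0)"
proof -
  have "(\<Sum>j=1..k. real (n j) * rise i j) = (\<Sum>j=1..k. if j = Suc i then real (n j) else 0)"
    by (intro sum.cong) (auto simp: rise_def)
  then show ?thesis by (simp add: sum.delta)
qed

text \<open>The guard \<open>2 \<le> j\<close> excludes the predecessor \<open>0\<close>, which
  never occurs in an arrangement although \<open>n 0\<close> may be nonzero.\<close>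

lemma sum_rise_left:
  "j \<le> k \<Longrightarrow> (\<Sum>i=1..k. real (n i) * rise i j) = (if 2 \<le> j then real (n (j - 1)) else 0)"
proof -
  assume "j \<le> k"
  have "(\<Sum>i=1..k. real (n i) * rise i j) =
      (\<Sum>i=1..k. if i = j - 1 then (if 2 \<le> j then real (n i) else 0) else 0)"
    by (intro sum.cong) (auto simp: rise_def)
  then show ?thesis using \<open>j \<le> k\<close> by (auto simp: sum.delta)
qed

lemma sum_below_top:
  fixes f :: "nat \<Rightarrow> real"
  assumes "k \<ge> 1"
  shows "(\<Sum>i=1..k. if i < k then f i else 0) = (\<Sum>i=1..k-1. f i)"
  by (rule sum.mono_neutral_cong_right) (use assms in auto)

lemma sum_above_bottom:
  fixes f :: "nat \<Rightarrow> real"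
  assumes "k \<ge> 1"
  shows "(\<Sum>j=1..k. if 2 \<le> j then f (j - 1) else 0) = (\<Sum>i=1..k-1. f i)"
proof -
  have "(\<Sum>j=1..k. if 2 \<le> j then f (j - 1) else 0) = (\<Sum>j=2..k. f (j - 1))"
    by (rule sum.mono_neutral_cong_right) (use assms in auto)
  also have "\<dots> = (\<Sum>i=1..k-1. f i)"
    by (rule sum.reindex_bij_witness[where i = Suc and j = "\<lambda>j. j - 1"]) auto
  finally show ?thesis .
qed

context
  fixes k :: nat and n :: "nat \<Rightarrow> nat" and xs :: "nat list"
  assumes k: "k \<ge> 1" and xs: "xs \<in> arrangements k n"
begin

lemma sum_rise_positions:
  "(\<Sum>p<length xs. \<Sum>q<length xs. rise (xs ! p) (xs ! q)) = T1 k n"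
proof -
  have "(\<Sum>p<length xs. \<Sum>q<length xs. rise (xs ! p) (xs ! q)) =
      (\<Sum>i=1..k. if i < k then real (n i) * real (n (i + 1)) else 0)"
    unfolding arrangements_sum_nth[OF xs, of "\<lambda>b. rise _ b"] sum_rise_right
      arrangements_sum_nth[OF xs, of "\<lambda>a. if a < k then real (n (Suc a)) else 0"]
    by (intro sum.cong) auto
  then show ?thesis unfolding sum_below_top[OF k] T1_def .
qed

text \<open>The squared inner sum counts ordered pairs of rises from the same position
  \<open>p\<close>, one of the coincidences to be removed from the sum over four positions.\<close>

lemma sum_rise_common_start:
  "(\<Sum>p<length xs. (\<Sum>q<length xs. rise (xs ! p) (xs ! q))\<^sup>2) =
   (\<Sum>i=1..k-1. real (n i) * (real (n (i + 1)))\<^sup>2)"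
proof -
  have "(\<Sum>p<length xs. (\<Sum>q<length xs. rise (xs ! p) (xs ! q))\<^sup>2) =
      (\<Sum>i=1..k. if i < k then real (n i) * (real (n (i + 1)))\<^sup>2 else 0)"
    unfolding arrangements_sum_nth[OF xs, of "\<lambda>b. rise _ b"] sum_rise_right
      arrangements_sum_nth[OF xs, of "\<lambda>a. (if a < k then real (n (Suc a)) else 0)\<^sup>2"]
    by (intro sum.cong) auto
  then show ?thesis unfolding sum_below_top[OF k] .
qed

lemma sum_rise_common_end:
  "(\<Sum>q<length xs. (\<Sum>p<length xs. rise (xs ! p) (xs ! q))\<^sup>2) =
   (\<Sum>i=1..k-1. (real (n i))\<^sup>2 * real (n (i + 1)))"
proof -
  have "(\<Sum>q<length xs. (\<Sum>p<length xs. rise (xs ! p) (xs ! q))\<^sup>2) =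
      (\<Sum>j=1..k. real (n j) * (\<Sum>i=1..k. real (n i) * rise i j)\<^sup>2)"
    unfolding arrangements_sum_nth[OF xs, of "\<lambda>a. rise a _"]
      arrangements_sum_nth[OF xs, of "\<lambda>b. (\<Sum>i=1..k. real (n i) * rise i b)\<^sup>2"] ..
  also have "\<dots> = (\<Sum>j=1..k. if 2 \<le> j then (real (n (j - 1)))\<^sup>2 * real (n (j - 1 + 1)) else 0)"
    by (intro sum.cong) (auto simp: sum_rise_left simp del: One_nat_def)
  finally show ?thesis
    unfolding sum_above_bottom[OF k, of "\<lambda>i. (real (n i))\<^sup>2 * real (n (i + 1))"] .
qed

end


section \<open>Sums over distinct tuples for an asymmetric relation, and over index pairs\<close>

lemma sum_remove_two:
  fixes f :: "'a \<Rightarrow> real"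
  assumes "finite S" "p \<in> S" "q \<in> S" "p \<noteq> q"
  shows "(\<Sum>x\<in>S. if x = p \<or> x = q then 0 else f x) = (\<Sum>x\<in>S. f x) - f p - f q"
proof -
  have "(\<Sum>x\<in>S. if x = p \<or> x = q then 0 else f x) =
      (\<Sum>x\<in>S. f x - (if x = p then f x else 0) - (if x = q then f x else 0))"
    using assms(4) by (intro sum.cong) auto
  then show ?thesis using assms by (simp add: sum_subtractf sum.delta)
qed

text \<open>\<open>X\<close> is the adjacency matrix of a directed graph without loops or 2-cycles;
  \<open>idem\<close> forces the entries to be 0 or 1. Row and column sums are out- and
  in-degrees.\<close>

context
  fixes S :: "'a set" and X :: "'a \<Rightarrow> 'a \<Rightarrow> real"
  assumes fin: "finite S" and diag: "\<And>p. X p p = 0" and asym: "\<And>p q. X p q * X q p = 0"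
    and idem: "\<And>p q. X p q * X p q = X p q"
begin

lemma sum_distinct_pairs:
  "(\<Sum>ps\<in>distinct_lists 2 S. X (ps ! 0) (ps ! 1)) = (\<Sum>p\<in>S. \<Sum>q\<in>S. X p q)"
  unfolding numeral_2_eq_2 sum_distinct_lists_Suc[OF fin] distinct_lists_0
  by (intro sum.cong refl) (auto simp: diag)

text \<open>The coincidences \<open>p = q\<close> and \<open>q = r\<close> contribute nothing by
  \<open>diag\<close>, and \<open>p = r\<close> nothing by \<open>asym\<close>, so the sum over all
  triples is the same.\<close>

lemma sum_distinct_triples:
  "(\<Sum>ps\<in>distinct_lists 3 S. X (ps ! 0) (ps ! 1) * X (ps ! 1) (ps ! 2)) =
   (\<Sum>q\<in>S. (\<Sum>p\<in>S. X p q) * (\<Sum>r\<in>S. X q r))"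
proof -
  have "(\<Sum>ps\<in>distinct_lists 3 S. X (ps ! 0) (ps ! 1) * X (ps ! 1) (ps ! 2)) =
      (\<Sum>p\<in>S. \<Sum>q\<in>S. \<Sum>r\<in>S. X p q * X q r)"
    unfolding numeral_3_eq_3 numeral_2_eq_2 sum_distinct_lists_Suc[OF fin] distinct_lists_0
    by (intro sum.cong refl) (auto simp: diag, metis asym mult_eq_0_iff)
  also have "\<dots> = (\<Sum>q\<in>S. \<Sum>p\<in>S. \<Sum>r\<in>S. X p q * X q r)"
    by (rule sum.swap)
  finally show ?thesis by (simp add: sum_product)
qed

text \<open>Inclusion-exclusion on pairs of arcs: remove those with a common start or a common end,
  add back the equal arcs removed twice, and remove the two kinds of directed paths. Opposite arcs
  vanish by \<open>asym\<close>.\<close>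

lemma sum_distinct_quadruples:
  "(\<Sum>ps\<in>distinct_lists 4 S. X (ps ! 0) (ps ! 1) * X (ps ! 2) (ps ! 3)) =
   (\<Sum>p\<in>S. \<Sum>q\<in>S. X p q)\<^sup>2 - (\<Sum>p\<in>S. (\<Sum>q\<in>S. X p q)\<^sup>2) - (\<Sum>q\<in>S. (\<Sum>p\<in>S. X p q)\<^sup>2)
   + (\<Sum>p\<in>S. \<Sum>q\<in>S. X p q) - 2 * (\<Sum>q\<in>S. (\<Sum>p\<in>S. X p q) * (\<Sum>r\<in>S. X q r))"
proof -
  define row where "row p = (\<Sum>q\<in>S. X p q)" for p
  define col where "col q = (\<Sum>p\<in>S. X p q)" for q
  define T where "T = (\<Sum>p\<in>S. row p)"
  have T_col: "T = (\<Sum>q\<in>S. col q)"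
    unfolding T_def row_def col_def by (rule sum.swap)
  have 4: "4 = Suc (Suc (Suc (Suc 0)))" by simp
  have inner: "(\<Sum>r\<in>S. \<Sum>s\<in>S. if distinct [p, q, r, s] then X p q * X r s else 0) =
      X p q * (T - row p - col q + 1 - row q - col p)"
    if pq: "p \<in> S" "q \<in> S" for p q
  proof (cases "p = q")
    case False
    have "(\<Sum>r\<in>S. \<Sum>s\<in>S. if distinct [p, q, r, s] then X p q * X r s else 0) =
        X p q * (\<Sum>r\<in>S. if r = p \<or> r = q then 0 else \<Sum>s\<in>S. if s = p \<or> s = q then 0 else X r s)"
      unfolding sum_distrib_left using False
      by (intro sum.cong refl) (auto simp: diag sum_distrib_left intro!: sum.cong)
    \<comment> \<open>Arcs starting at \<open>p\<close> or \<open>q\<close> go first; the arcs into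
      \<open>p\<close> and \<open>q\<close> are then removed except those already gone. By
      \<open>idem\<close>, the restored \<open>X p q\<close> becomes the \<open>+ 1\<close> of the
      claim.\<close>
    also have "\<dots> = X p q * (T - row p - row q - (col p - X q p) - (col q - X p q))"
      using sum_remove_two[OF fin pq False]
      by (simp add: row_def[symmetric] col_def[symmetric] T_def[symmetric] sum_subtractf diag)
    also have "\<dots> = X p q * (T - row p - col q - row q - col p) + X p q * X q p + X p q * X p q"
      by (simp add: algebra_simps)
    finally show ?thesis by (simp add: asym idem algebra_simps)
  qed (simp add: diag)
  have "(\<Sum>ps\<in>distinct_lists 4 S. X (ps ! 0) (ps ! 1) * X (ps ! 2) (ps ! 3)) =
      (\<Sum>p\<in>S. \<Sum>q\<in>S. \<Sum>r\<in>S. \<Sum>s\<in>S. if distinct [p, q, r, s] then X p q * X r s else 0)"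
    unfolding 4 sum_distinct_lists_Suc[OF fin] distinct_lists_0
    by (intro sum.cong refl) (auto simp: numeral_2_eq_2 numeral_3_eq_3)
  also have "\<dots> = (\<Sum>p\<in>S. \<Sum>q\<in>S. X p q * (T - row p - col q + 1 - row q - col p))"
    by (intro sum.cong refl inner)
  \<comment> \<open>Factors depending on the start \<open>p\<close> are separated from those
    depending on the end \<open>q\<close>: summing \<open>X p q\<close> over the other index gives
    \<open>row p\<close> and \<open>col q\<close> respectively.\<close>
  also have "\<dots> = (\<Sum>p\<in>S. \<Sum>q\<in>S. X p q * (T + 1 - row p - col p)) -
      (\<Sum>p\<in>S. \<Sum>q\<in>S. X p q * (col q + row q))"
    unfolding sum_subtractf[symmetric] by (simp add: algebra_simps)
  also have "(\<Sum>p\<in>S. \<Sum>q\<in>S. X p q * (T + 1 - row p - col p)) =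
      (\<Sum>p\<in>S. row p * (T + 1 - row p - col p))"
    unfolding row_def sum_distrib_right ..
  also have "\<dots> = (\<Sum>p\<in>S. row p) * (T + 1) - (\<Sum>p\<in>S. (row p)\<^sup>2) - (\<Sum>p\<in>S. col p * row p)"
    unfolding sum_distrib_right sum_subtractf[symmetric]
    by (simp add: algebra_simps power2_eq_square)
  also have "(\<Sum>p\<in>S. \<Sum>q\<in>S. X p q * (col q + row q)) = (\<Sum>q\<in>S. col q * (col q + row q))"
    unfolding col_def sum_distrib_right by (rule sum.swap)
  also have "\<dots> = (\<Sum>q\<in>S. (col q)\<^sup>2) + (\<Sum>q\<in>S. col q * row q)"
    by (simp add: algebra_simps power2_eq_square sum.distrib)
  finally show ?thesis
    unfolding row_def[symmetric] col_def[symmetric] T_def[symmetric]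
    by (simp add: algebra_simps power2_eq_square)
qed

end

text \<open>A square of side \<open>m + 1\<close> has \<open>m + 1\<close> diagonal entries,
  \<open>2 * m\<close> next to the diagonal and \<open>m * (m - 1)\<close> others. The induction
  adds a last row and column, each with one \<open>b\<close> and \<open>m\<close> entries
  \<open>c\<close>, and the corner \<open>a\<close>.\<close>

lemma sum_by_adjacency:
  fixes a b c :: real
  shows "(\<Sum>s<Suc m. \<Sum>t<Suc m. if s = t then a else if t = Suc s \<or> s = Suc t then b else c) =
         (real m + 1) * a + 2 * real m * b + real m * (real m - 1) * c"
proof (induction m)
  case (Suc m)
  let ?f = "\<lambda>s t. if s = t then a else if t = Suc s \<or> s = Suc t then b else c"
  have "(\<Sum>t<m. ?f (Suc m) t) = real m * c" "(\<Sum>s<m. ?f s (Suc m)) = real m * c"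
    by simp_all
  then have "(\<Sum>t<Suc m. ?f (Suc m) t) = real m * c + b" "(\<Sum>s<Suc m. ?f s (Suc m)) = real m * c + b"
    by simp_all
  moreover have "(\<Sum>s<Suc (Suc m). \<Sum>t<Suc (Suc m). ?f s t) =
      (\<Sum>s<Suc m. \<Sum>t<Suc m. ?f s t) + (\<Sum>s<Suc m. ?f s (Suc m)) + (\<Sum>t<Suc m. ?f (Suc m) t) + a"
    by (simp only: sum.lessThan_Suc[of _ "Suc m"] sum.distrib) simp
  ultimately show ?case
    by (simp only: Suc.IH) (simp add: algebra_simps)
qed simp

section \<open>Averages over arrangements\<close>

definition mean :: "nat \<Rightarrow> (nat \<Rightarrow> nat) \<Rightarrow> (nat list \<Rightarrow> real) \<Rightarrow> real" where
  "mean k n f = (\<Sum>xs\<in>arrangements k n. f xs) / real (card (arrangements k n))"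

lemma expectation_eq_mean:
  "measure_pmf.expectation (pmf_of_set (arrangements k n)) f = mean k n f"
  by (simp add: mean_def integral_pmf_of_set finite_arrangements arrangements_nonempty)

lemma mean_sum: "mean k n (\<lambda>xs. \<Sum>i\<in>I. f i xs) = (\<Sum>i\<in>I. mean k n (f i))"
  unfolding mean_def sum_divide_distrib[symmetric] by (subst sum.swap) simp

lemma mean_cong: "(\<And>xs. xs \<in> arrangements k n \<Longrightarrow> f xs = g xs) \<Longrightarrow> mean k n f = mean k n g"
  by (simp add: mean_def)

text \<open>This is \<open>card_distinct_lists_times_sum\<close> divided by the number of
  arrangements, which is positive.\<close>

lemma mean_at_positions:
  assumes "qs \<in> distinct_lists m {..<\<Sum>i=1..k. n i}"
    and "\<And>xs. xs \<in> arrangements k n \<Longrightarrow>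
          (\<Sum>ps\<in>distinct_lists m {..<length xs}. F (map ((!) xs) ps)) = C"
  shows "real (card (distinct_lists m {..<\<Sum>i=1..k. n i})) * mean k n (\<lambda>xs. F (map ((!) xs) qs)) = C"
proof -
  let ?M = "\<Sum>j\<in>{1..k}. replicate_mset (n j) j"
  have size: "size ?M = (\<Sum>i=1..k. n i)"
    by (simp add: size_multiset_sum)
  have len: "length xs = (\<Sum>i=1..k. n i)" if "xs \<in> arrangements k n" for xs
    using that by (simp add: arrangements_def)
  have "real (card (distinct_lists m {..<size ?M})) *
      (\<Sum>xs\<in>permutations_of_multiset ?M. F (map ((!) xs) qs)) =
      real (card (permutations_of_multiset ?M)) * C"
    by (rule card_distinct_lists_times_sum)
      (use assms(1) assms(2) len in \<open>unfold size arrangements_eq[symmetric], auto\<close>)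
  then show ?thesis
    using finite_arrangements[of k n] arrangements_nonempty[of k n]
    unfolding size arrangements_eq[symmetric] mean_def by (simp add: field_simps)
qed

section \<open>Totals over two, three and four distinct positions\<close>

lemma rise_idem: "rise p q * rise p q = rise p q"
  by (simp add: rise_def)

text \<open>\<open>T2\<close> counts position triples with consecutive values. It is never evaluated, because it
  cancels in the second moment.\<close>

definition T2 :: "nat \<Rightarrow> (nat \<Rightarrow> nat) \<Rightarrow> real" where
  "T2 k n = (\<Sum>j=1..k. real (n j) *
     ((\<Sum>i=1..k. real (n i) * rise i j) * (\<Sum>l=1..k. real (n l) * rise j l)))"

lemma sum_rise_triples:
  assumes "xs \<in> arrangements k n"
  shows "(\<Sum>q<length xs. (\<Sum>p<length xs. rise (xs ! p) (xs ! q)) * (\<Sum>r<length xs. rise (xs ! q) (xs ! r)))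
    = T2 k n"
  unfolding T2_def arrangements_sum_nth[OF assms, of "\<lambda>a. rise a _"]
    arrangements_sum_nth[OF assms, of "\<lambda>b. rise _ b"]
    arrangements_sum_nth[OF assms, of "\<lambda>j. (\<Sum>i=1..k. real (n i) * rise i j) * (\<Sum>l=1..k. real (n l) * rise j l)"] ..

text \<open>Counts the pairs of rises at four distinct positions, by inclusion-exclusion over the
  coincidences of start and end positions.\<close>

definition T11 :: "nat \<Rightarrow> (nat \<Rightarrow> nat) \<Rightarrow> real" where
  "T11 k n = (T1 k n)\<^sup>2 - (\<Sum>i=1..k-1. real (n i) * (real (n (i + 1)))\<^sup>2)
     - (\<Sum>i=1..k-1. (real (n i))\<^sup>2 * real (n (i + 1))) + T1 k n - 2 * T2 k n"

context
  fixes k :: nat and n :: "nat \<Rightarrow> nat" and xs :: "nat list"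
  assumes k: "k \<ge> 1" and xs: "xs \<in> arrangements k n"
begin

text \<open>Values are read through \<open>map ((!) xs) ps\<close> to match the form in which
  \<open>mean_at_positions\<close> takes its function \<open>F\<close>.\<close>

lemma sum_positions_2:
  "(\<Sum>ps\<in>distinct_lists 2 {..<length xs}.
      rise (map ((!) xs) ps ! 0) (map ((!) xs) ps ! 1)) = T1 k n"
proof -
  have "(\<Sum>ps\<in>distinct_lists 2 {..<length xs}.
      rise (map ((!) xs) ps ! 0) (map ((!) xs) ps ! 1)) =
    (\<Sum>ps\<in>distinct_lists 2 {..<length xs}.
      rise (xs ! (ps ! 0)) (xs ! (ps ! 1)))"
    by (auto simp: distinct_lists_def intro!: sum.cong)
  also have "\<dots> = T1 k n"
    unfolding sum_rise_positions[OF k xs, symmetric]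
    by (rule sum_distinct_pairs) (simp_all add: rise_def)
  finally show ?thesis .
qed

lemma sum_positions_3:
  "(\<Sum>ps\<in>distinct_lists 3 {..<length xs}.
      rise (map ((!) xs) ps ! 0) (map ((!) xs) ps ! 1) *
      rise (map ((!) xs) ps ! 1) (map ((!) xs) ps ! 2)) = T2 k n"
proof -
  have "(\<Sum>ps\<in>distinct_lists 3 {..<length xs}.
      rise (map ((!) xs) ps ! 0) (map ((!) xs) ps ! 1) *
      rise (map ((!) xs) ps ! 1) (map ((!) xs) ps ! 2)) =
    (\<Sum>ps\<in>distinct_lists 3 {..<length xs}.
      rise (xs ! (ps ! 0)) (xs ! (ps ! 1)) * rise (xs ! (ps ! 1)) (xs ! (ps ! 2)))"
    by (auto simp: distinct_lists_def intro!: sum.cong)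
  also have "\<dots> = T2 k n"
    unfolding sum_rise_triples[OF xs, symmetric]
    by (rule sum_distinct_triples) (simp_all add: rise_def)
  finally show ?thesis .
qed

lemma sum_positions_4:
  "(\<Sum>ps\<in>distinct_lists 4 {..<length xs}.
      rise (map ((!) xs) ps ! 0) (map ((!) xs) ps ! 1) *
      rise (map ((!) xs) ps ! 2) (map ((!) xs) ps ! 3)) = T11 k n"
proof -
  have "(\<Sum>ps\<in>distinct_lists 4 {..<length xs}.
      rise (map ((!) xs) ps ! 0) (map ((!) xs) ps ! 1) *
      rise (map ((!) xs) ps ! 2) (map ((!) xs) ps ! 3)) =
    (\<Sum>ps\<in>distinct_lists 4 {..<length xs}.
      rise (xs ! (ps ! 0)) (xs ! (ps ! 1)) * rise (xs ! (ps ! 2)) (xs ! (ps ! 3)))"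
    by (auto simp: distinct_lists_def intro!: sum.cong)
  also have "\<dots> = T11 k n"
    unfolding T11_def
      sum_rise_positions[OF k xs, symmetric] sum_rise_common_start[OF k xs, symmetric]
      sum_rise_common_end[OF k xs, symmetric] sum_rise_triples[OF xs, symmetric]
    by (rule sum_distinct_quadruples) (simp_all add: rise_def)
  finally show ?thesis .
qed

end

section \<open>First and second moments of the number of rises\<close>

lemma card_distinct_lists_234:
  assumes "finite S"
  shows "2 \<le> card S \<Longrightarrow> real (card (distinct_lists 2 S)) = real (card S) * (real (card S) - 1)"
    and "3 \<le> card S \<Longrightarrow> real (card (distinct_lists 3 S)) =
      real (card S) * (real (card S) - 1) * (real (card S) - 2)"
    and "4 \<le> card S \<Longrightarrow> real (card (distinct_lists 4 S)) =
      real (card S) * (real (card S) - 1) * (real (card S) - 2) * (real (card S) - 3)"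
proof -
  have n: "2 = Suc (Suc 0)" "3 = Suc (Suc (Suc 0))" "4 = Suc (Suc (Suc (Suc 0)))" by simp_all
  show "2 \<le> card S \<Longrightarrow> real (card (distinct_lists 2 S)) = real (card S) * (real (card S) - 1)"
    and "3 \<le> card S \<Longrightarrow> real (card (distinct_lists 3 S)) =
      real (card S) * (real (card S) - 1) * (real (card S) - 2)"
    and "4 \<le> card S \<Longrightarrow> real (card (distinct_lists 4 S)) =
      real (card S) * (real (card S) - 1) * (real (card S) - 2) * (real (card S) - 3)"
    unfolding n by (simp_all add: card_distinct_lists_Suc[OF assms] distinct_lists_0)
qed

context
  fixes k N :: nat and n :: "nat \<Rightarrow> nat"
  assumes k: "k \<ge> 1" and N: "N = (\<Sum>i=1..k. n i)" and N2: "N \<ge> 2"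
begin

lemma mean_rise:
  assumes "Suc s < N"
  shows "mean k n (\<lambda>xs. rise (xs ! s) (xs ! Suc s)) = T1 k n / (real N * (real N - 1))"
proof -
  have "[s, Suc s] \<in> distinct_lists 2 {..<\<Sum>i=1..k. n i}"
    using assms by (simp add: distinct_lists_def N)
  from mean_at_positions[where k = k and n = n and F = "\<lambda>ys. rise (ys ! 0) (ys ! 1)",
      OF this sum_positions_2[OF k, where n = n]]
  have "real (card (distinct_lists 2 {..<N})) * mean k n (\<lambda>xs. rise (xs ! s) (xs ! Suc s)) = T1 k n"
    by (simp add: N)
  then show ?thesis
    using N2 by (subst nonzero_eq_divide_eq) (simp_all add: card_distinct_lists_234 mult_ac)
qed

lemma mean_rise_adjacent:
  assumes "Suc (Suc s) < N"
  shows "mean k n (\<lambda>xs. rise (xs ! s) (xs ! Suc s) * rise (xs ! Suc s) (xs ! Suc (Suc s))) =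
    T2 k n / (real N * (real N - 1) * (real N - 2))"
proof -
  have "[s, Suc s, Suc (Suc s)] \<in> distinct_lists 3 {..<\<Sum>i=1..k. n i}"
    using assms by (simp add: distinct_lists_def N)
  from mean_at_positions[where k = k and n = n and F = "\<lambda>ys. rise (ys ! 0) (ys ! 1) * rise (ys ! 1) (ys ! 2)",
      OF this sum_positions_3[OF k, where n = n]]
  have "real (card (distinct_lists 3 {..<N})) * mean k n (\<lambda>xs. rise (xs ! s) (xs ! Suc s) * rise (xs ! Suc s) (xs ! Suc (Suc s))) = T2 k n"
    by (simp add: N)
  then show ?thesis
    using assms by (subst nonzero_eq_divide_eq) (simp_all add: card_distinct_lists_234 mult_ac)
qed

lemma mean_rise_disjoint:
  assumes "Suc s < N" "Suc t < N" "s \<noteq> t" "t \<noteq> Suc s" "s \<noteq> Suc t"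
  shows "mean k n (\<lambda>xs. rise (xs ! s) (xs ! Suc s) * rise (xs ! t) (xs ! Suc t)) =
    T11 k n / (real N * (real N - 1) * (real N - 2) * (real N - 3))"
proof -
  \<comment> \<open>Two disjoint pairs of neighbouring positions occupy four places, so no factor of
    the denominator vanishes.\<close>
  have "N \<ge> 4" using assms by auto
  have "[s, Suc s, t, Suc t] \<in> distinct_lists 4 {..<\<Sum>i=1..k. n i}"
    using assms by (simp add: distinct_lists_def N)
  from mean_at_positions[where k = k and n = n and F = "\<lambda>ys. rise (ys ! 0) (ys ! 1) * rise (ys ! 2) (ys ! 3)",
      OF this sum_positions_4[OF k, where n = n]]
  have "real (card (distinct_lists 4 {..<N})) * mean k n (\<lambda>xs. rise (xs ! s) (xs ! Suc s) * rise (xs ! t) (xs ! Suc t)) = T11 k n"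
    by (simp add: N numeral_3_eq_3)
  then show ?thesis
    using \<open>N \<ge> 4\<close> by (subst nonzero_eq_divide_eq) (simp_all add: card_distinct_lists_234 mult_ac)
qed

text \<open>With too few positions there are no distinct triples or quadruples to sum over. This
  settles the small \<open>N\<close> for which the factor \<open>N - 2\<close> or
  \<open>N - 3\<close> is zero.\<close>

lemma T2_eq_0: "N < 3 \<Longrightarrow> T2 k n = 0"
  and T11_eq_0: "N < 4 \<Longrightarrow> T11 k n = 0"
proof -
  obtain xs where xs: "xs \<in> arrangements k n" using arrangements_nonempty by blast
  then have "length xs = N" by (simp add: arrangements_def N)
  then show "N < 3 \<Longrightarrow> T2 k n = 0" "N < 4 \<Longrightarrow> T11 k n = 0"
    using sum_positions_3[OF k xs] sum_positions_4[OF k xs] by (simp_all add: distinct_lists_empty)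
qed

lemma mean_unit_rises: "mean k n (\<lambda>xs. real (unit_rises xs)) = T1 k n / real N"
proof -
  have "mean k n (\<lambda>xs. real (unit_rises xs)) = mean k n (\<lambda>xs. \<Sum>t<N - 1. rise (xs ! t) (xs ! Suc t))"
    by (rule mean_cong) (simp add: unit_rises_eq_sum arrangements_def N)
  also have "\<dots> = (\<Sum>t<N - 1. T1 k n / (real N * (real N - 1)))"
    unfolding mean_sum by (intro sum.cong refl mean_rise) auto
  also have "\<dots> = T1 k n / real N"
    using N2 by (simp add: of_nat_diff)
  finally show ?thesis .
qed

text \<open>Of the pairs of indices below \<open>N - 1\<close>, there are \<open>N - 1\<close>
  equal, \<open>2 * (N - 2)\<close> adjacent and \<open>(N - 2) * (N - 3)\<close> other ones; these
  counts cancel against the falling factorials in the means.\<close>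

lemma mean_unit_rises_squared:
  "mean k n (\<lambda>xs. (real (unit_rises xs))\<^sup>2) =
   T1 k n / real N + (2 * T2 k n + T11 k n) / (real N * (real N - 1))"
proof -
  let ?g = "\<lambda>s xs. rise (xs ! s) (xs ! Suc s)"
  define a where "a = T1 k n / (real N * (real N - 1))"
  define b where "b = T2 k n / (real N * (real N - 1) * (real N - 2))"
  define c where "c = T11 k n / (real N * (real N - 1) * (real N - 2) * (real N - 3))"
  obtain m where m: "N = Suc (Suc m)" using N2 by (metis add_2_eq_Suc le_Suc_ex)
  have len: "length xs = Suc (Suc m)" if "xs \<in> arrangements k n" for xs
    using that N m by (simp add: arrangements_def)
  have "mean k n (\<lambda>xs. (real (unit_rises xs))\<^sup>2) =
      mean k n (\<lambda>xs. \<Sum>s<Suc m. \<Sum>t<Suc m. ?g s xs * ?g t xs)"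
    by (rule mean_cong)
      (simp add: unit_rises_eq_sum len power2_eq_square sum_product del: sum.lessThan_Suc)
  also have "\<dots> = (\<Sum>s<Suc m. \<Sum>t<Suc m. if s = t then a else if t = Suc s \<or> s = Suc t then b else c)"
    unfolding mean_sum
  proof (intro sum.cong refl)
    fix s t assume "s \<in> {..<Suc m}" "t \<in> {..<Suc m}"
    then have st: "Suc s < N" "Suc t < N" by (auto simp: m)
    consider "s = t" | "t = Suc s" | "s = Suc t" | "s \<noteq> t" "t \<noteq> Suc s" "s \<noteq> Suc t" by blast
    then show "mean k n (\<lambda>xs. ?g s xs * ?g t xs) =
        (if s = t then a else if t = Suc s \<or> s = Suc t then b else c)"
    proof cases
      case 1
      then show ?thesis using mean_rise st by (simp add: rise_idem a_def)
    next
      case 2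
      then show ?thesis using mean_rise_adjacent st by (simp add: b_def)
    next
      case 3
      then show ?thesis using mean_rise_adjacent st by (simp add: b_def mult.commute)
    next
      case 4
      then show ?thesis using mean_rise_disjoint st by (simp add: c_def)
    qed
  qed
  also have "\<dots> = (real m + 1) * a + 2 * real m * b + real m * (real m - 1) * c"
    by (rule sum_by_adjacency)
  also have "(real m + 1) * a = T1 k n / real N"
    by (simp add: a_def m add.commute)
  \<comment> \<open>Here \<open>m = N - 2\<close> cancels a factor of \<open>b\<close>. For
    \<open>m = 0\<close> the left side is 0, and the right side is 0 because \<open>T2\<close>
    is.\<close>
  also have "2 * real m * b = 2 * T2 k n / (real N * (real N - 1))"
    by (cases "m = 0") (use T2_eq_0 in \<open>simp_all add: b_def m\<close>)
  \<comment> \<open>The cases \<open>m = 0\<close> and \<open>m = 1\<close> are \<open>N = 2\<close>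
    and \<open>N = 3\<close>, where \<open>T11\<close> vanishes.\<close>
  also have "real m * (real m - 1) * c = T11 k n / (real N * (real N - 1))"
    by (cases "m \<le> 1") (use T11_eq_0 in \<open>simp_all add: c_def m\<close>)
  finally show ?thesis by (simp add: add_divide_distrib)
qed

text \<open>Adjacent index pairs restore exactly the directed paths that \<open>T11\<close> removes;
  the common-start and common-end corrections merge into one sum.\<close>

lemma T2_T11:
  "2 * T2 k n + T11 k n = (T1 k n)\<^sup>2
     - (\<Sum>i=1..k-1. real (n i) * real (n (i + 1)) * (real (n i) + real (n (i + 1)))) + T1 k n"
  by (simp add: T11_def algebra_simps power2_eq_square sum.distrib)

end

section \<open>Factorial moment and variance\<close>

theorem theorem5:
  fixes k N :: nat and n :: "nat \<Rightarrow> nat" and P :: "nat list pmf" and R :: "nat list \<Rightarrow> real"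
  assumes "k \<ge> 1"
    and "N = (\<Sum>i=1..k. n i)"
    and "N \<ge> 2"
    and "P = pmf_of_set (arrangements k n)"
    and "R = (\<lambda>xs. real (unit_rises xs))"
  shows "measure_pmf.expectation P (\<lambda>xs. R xs * (R xs - 1)) =
      1 / (real N * (real N - 1)) *
        ((T1 k n)\<^sup>2
          - (\<Sum>i=1..k-1. real (n i) * real (n (i + 1)) * (real (n i) + real (n (i + 1)) - 1)))
    \<and> measure_pmf.variance P R =
      (T1 k n)\<^sup>2 / ((real N)\<^sup>2 * (real N - 1)) + T1 k n / (real N - 1)
        - 1 / (real N * (real N - 1)) *
          (\<Sum>i=1..k-1. real (n i) * real (n (i + 1)) * (real (n i) + real (n (i + 1))))"
proof
  let ?S = "\<Sum>i=1..k-1. real (n i) * real (n (i + 1)) * (real (n i) + real (n (i + 1)))"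
  have N: "real N \<ge> 2" using assms(3) by simp
  have "finite (set_pmf P)"
    by (simp add: assms(4) set_pmf_of_set finite_arrangements arrangements_nonempty)
  then have int: "integrable (measure_pmf P) f" for f :: "nat list \<Rightarrow> real"
    by (rule integrable_measure_pmf_finite)
  have E: "measure_pmf.expectation P R = T1 k n / real N"
    unfolding assms(4,5) expectation_eq_mean by (rule mean_unit_rises[OF assms(1-3)])
  have E2: "measure_pmf.expectation P (\<lambda>xs. (R xs)\<^sup>2) =
      T1 k n / real N + ((T1 k n)\<^sup>2 - ?S + T1 k n) / (real N * (real N - 1))"
    unfolding assms(4,5) expectation_eq_mean
      mean_unit_rises_squared[OF assms(1-3)] T2_T11[OF assms(1-3)] ..
  have "measure_pmf.expectation P (\<lambda>xs. R xs * (R xs - 1)) =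
      measure_pmf.expectation P (\<lambda>xs. (R xs)\<^sup>2) - measure_pmf.expectation P R"
    by (simp add: Bochner_Integration.integral_diff[OF int int, symmetric]
        power2_eq_square algebra_simps)
  also have "\<dots> = 1 / (real N * (real N - 1)) * ((T1 k n)\<^sup>2 - (?S - T1 k n))"
    unfolding E E2 by (simp add: diff_diff_eq2 add_diff_eq diff_add_eq)
  \<comment> \<open>Subtracting \<open>T1\<close> termwise puts the \<open>- 1\<close> into each
    summand.\<close>
  also have "?S - T1 k n =
      (\<Sum>i=1..k-1. real (n i) * real (n (i + 1)) * (real (n i) + real (n (i + 1)) - 1))"
    unfolding T1_def sum_subtractf[symmetric] by (simp add: algebra_simps)
  finally show "measure_pmf.expectation P (\<lambda>xs. R xs * (R xs - 1)) =
      1 / (real N * (real N - 1)) * ((T1 k n)\<^sup>2 -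
        (\<Sum>i=1..k-1. real (n i) * real (n (i + 1)) * (real (n i) + real (n (i + 1)) - 1)))" .
  have "measure_pmf.variance P R = measure_pmf.expectation P (\<lambda>xs. (R xs)\<^sup>2)
      - (measure_pmf.expectation P R)\<^sup>2"
    by (rule measure_pmf.variance_eq[OF int int])
  also have "\<dots> = (T1 k n)\<^sup>2 / ((real N)\<^sup>2 * (real N - 1)) + T1 k n / (real N - 1)
      - 1 / (real N * (real N - 1)) * ?S"
    \<comment> \<open>The squares combine by
      \<open>1 / (N * (N - 1)) - 1 / N^2 = 1 / (N^2 * (N - 1))\<close>, the linear terms by
      \<open>1 / N + 1 / (N * (N - 1)) = 1 / (N - 1)\<close>.\<close>
    unfolding E E2 using N by (simp add: divide_simps) (simp add: algebra_simps power2_eq_square)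
  finally show "measure_pmf.variance P R =
      (T1 k n)\<^sup>2 / ((real N)\<^sup>2 * (real N - 1)) + T1 k n / (real N - 1)
      - 1 / (real N * (real N - 1)) * ?S" .
qed

end
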